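(* Let $(y_n,z_n)_{n\ge 0}$ be a solution of the $m$-step BDF discretization with constant time step $\tau>0$, $$M(y_n)\,\frac1\tau\sum_{k=0}^m \alpha_k\, y_{n-m+k} + F(y_n) = C^\top z_n,$$ $$E\,\frac1\tau\sum_{k=0}^m \alpha_k\, z_{n-m+k} + A z_n = B y_n,$$ for all $n\ge 1$, with initial values $y_0=0$, $z_0=0$ and the convention $y_j=0$, $z_j=0$ for $j<0$. Let the matrix-valued quadrature weights $(\omega_n)_{n\ge 0}$ be the coefficients of the power series expansion about $\xi=0$ $$\widehat K\Big(\frac{\delta(\xi)}{\tau}\Big)=\sum_{n=0}^\infty \omega_n \xi^n,\qquad \widehat K(s)=C^\top(sE+A)^{-1}B,\qquad \delta(\xi)=\sum_{k=0}^m\alpha_k\xi^{m-k}.$$ Then for all $n\ge 1$ $$M(y_n)\,\frac1\tau\sum_{k=0}^m \alpha_k\, y_{n-m+k} + F(y_n) = \sum_{k=0}^n \omega_{n-k}\, y_k .$$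
   Context: The underlying coupled system is $M(y)\,\partial_t y+F(y)=C^\top z$, $E\,\partial_t z+Az=By$, $y(0)=0$, $z(0)=0$, which is finite dimensional: $y$ takes values in $\mathbb R^p$, $z$ in $\mathbb R^q$; $M:\mathbb R^p\to\mathbb R^{p\times p}$ and $F:\mathbb R^p\to\mathbb R^p$ are given (possibly nonlinear) functions; $E,A\in\mathbb R^{q\times q}$ and $B,C\in\mathbb R^{q\times p}$ are given constant matrices. The matrices $M(y)$ and $E$ are not required to be regular. It is assumed that $\frac{\delta(0)}{\tau}E+A$ is invertible, so that the function $\xi\mapsto\widehat K(\delta(\xi)/\tau)$ is analytic near $\xi=0$ and the weights are well defined. The numbers $\alpha_0,\dots,\alpha_m$ are the coefficients of the $m$-step BDF (backward differentiation) formula, i.e. $\partial_t y(t_n)\approx\frac1\tau\sum_{k=0}^m\alpha_k y_{n-m+k}$, with $\delta(\xi)=\sum_{k=0}^m\alpha_k\xi^{m-k}=\sum_{k=1}^m\frac1k(1-\xi)^k$; for instance, for $m=1$, $\alpha_1=1$, $\alpha_0=-1$ and $\delta(\xi)=1-\xi$. *)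

theory Defs
  imports "HOL-Analysis.Analysis"
begin

text \<open>Coefficients \<open>\<alpha>\<^sub>0, \<dots>, \<alpha>\<^sub>m\<close> of the \<open>m\<close>-step BDF formula, read off from
  \<open>\<Sum>\<^sub>k \<alpha>\<^sub>k \<xi>\<^bsup>m-k\<^esup> = \<Sum>\<^sub>j\<^sub>=\<^sub>1\<^sup>m (1 - \<xi>)\<^sup>j / j\<close>.\<close>

definition bdf_coeff :: "nat \<Rightarrow> nat \<Rightarrow> real" where
  "bdf_coeff m k = coeff (\<Sum>j=1..m. smult (1 / real j) ([:1, -1:] ^ j)) (m - k)"

definition bdf_delta :: "nat \<Rightarrow> 'a::real_normed_field \<Rightarrow> 'a" where
  "bdf_delta m \<xi> = (\<Sum>k=0..m. of_real (bdf_coeff m k) * \<xi> ^ (m - k))"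

lemma bdf_delta_altdef:
  "bdf_delta m (\<xi> :: 'a::real_normed_field) = (\<Sum>k=1..m. 1 / of_nat k * (1 - \<xi>) ^ k)"
proof -
  define P :: "real poly" where "P = (\<Sum>j=1..m. smult (1 / real j) ([:1, -1:] ^ j))"
  have degP: "degree P \<le> m"
    unfolding P_def
  proof (rule degree_sum_le)
    fix j assume "j \<in> {1..m}"
    then show "degree (smult (1 / real j) ([:1, -1:] ^ j)) \<le> m"
      using degree_power_le[of "[:1, -1:] :: real poly" j]
      by (intro order.trans[OF degree_smult_le]) auto
  qed simp
  have pm: "map_poly (of_real :: real \<Rightarrow> 'a) (\<Sum>i\<in>A. f i) = (\<Sum>i\<in>A. map_poly of_real (f i))"
    for A :: "nat set" and f
    by (intro poly_eqI) (simp add: coeff_map_poly coeff_sum)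
  have pw: "map_poly (of_real :: real \<Rightarrow> 'a) ([:1, -1:] ^ j) = [:1, -1:] ^ j" for j
  proof (induction j)
    case (Suc j)
    have "map_poly (of_real :: real \<Rightarrow> 'a) ([:1, -1:] * q) = [:1, -1:] * map_poly of_real q" for q
      by (rule poly_eqI) (simp add: coeff_map_poly coeff_pCons split: nat.split)
    then show ?case
      by (simp only: power_Suc Suc.IH)
  qed (simp add: map_poly_1)
  have "bdf_delta m \<xi> = (\<Sum>i\<le>m. of_real (coeff P i) * \<xi> ^ i)"
    unfolding bdf_delta_def bdf_coeff_def P_def[symmetric]
    by (rule sum.reindex_bij_witness[of _ "\<lambda>i. m - i" "\<lambda>k. m - k"]) auto
  also have "\<dots> = (\<Sum>i\<le>degree (map_poly of_real P :: 'a poly). of_real (coeff P i) * \<xi> ^ i)"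
    using degP
    by (intro sum.mono_neutral_right)
       (auto simp: degree_map_poly intro!: coeff_eq_0)
  also have "\<dots> = poly (map_poly of_real P) \<xi>"
    by (simp add: poly_altdef coeff_map_poly)
  also have "\<dots> = (\<Sum>k=1..m. 1 / of_nat k * (1 - \<xi>) ^ k)"
    unfolding P_def pm poly_sum
    by (intro sum.cong) (simp_all add: map_poly_smult pw)
  finally show ?thesis .
qed

text \<open>The difference quotient \<open>(1/\<tau>) \<Sum>\<^sub>k \<alpha>\<^sub>k v\<^bsub>n-m+k\<^esub>\<close>, with the convention \<open>v\<^sub>j = 0\<close> for \<open>j < 0\<close>.\<close>

definition bdf_diff :: "nat \<Rightarrow> real \<Rightarrow> (nat \<Rightarrow> 'v::real_vector) \<Rightarrow> nat \<Rightarrow> 'v" where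
  "bdf_diff m \<tau> v n =
     (1 / \<tau>) *\<^sub>R (\<Sum>k=0..m. bdf_coeff m k *\<^sub>R (if n + k < m then 0 else v (n + k - m)))"

definition transfer_fun ::
    "real^'q^'q \<Rightarrow> real^'q^'q \<Rightarrow> real^'p^'q \<Rightarrow> real^'p^'q \<Rightarrow> complex \<Rightarrow> complex^'p^'p" where
  "transfer_fun E A B C s =
     map_matrix of_real (transpose C)
       ** matrix_inv (mat s ** map_matrix of_real E + map_matrix of_real A)
       ** map_matrix of_real B"

text \<open>The power series expansion about \<open>\<xi> = 0\<close> of the matrix-valued function is taken entrywise,
  for complex \<open>\<xi>\<close>; the coefficients are real since all the data are.\<close>

definition is_quadrature_weights ::
    "nat \<Rightarrow> real \<Rightarrow> real^'q^'q \<Rightarrow> real^'q^'q \<Rightarrow> real^'p^'q \<Rightarrow> real^'p^'q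
      \<Rightarrow> (nat \<Rightarrow> real^'p^'p) \<Rightarrow> bool" where
  "is_quadrature_weights m \<tau> E A B C \<omega> \<longleftrightarrow>
     (\<forall>i j. (\<lambda>\<xi>. transfer_fun E A B C (bdf_delta m \<xi> / of_real \<tau>) $ i $ j)
              has_fps_expansion Abs_fps (\<lambda>n. of_real (\<omega> n $ i $ j)))"

end

theory Submission
  imports Defs "HOL-Complex_Analysis.Laurent_Convergence"
begin

text \<open>
  The BDF scheme is a discrete convolution, so it becomes multiplication when the sequences are
  replaced by their generating functions. Write \<open>Y(\<xi>)\<close> and \<open>Z(\<xi>)\<close> for the formal power series
  with coefficients \<open>y\<^sub>n\<close> and \<open>z\<^sub>n\<close>. The difference quotient of \<open>Z\<close> has the generating function
  \<open>(\<delta>(\<xi>)/\<tau>) Z(\<xi>)\<close>, since the values at negative indices are zero. The second equation of the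
  scheme therefore reads
  \[ P(\<xi>) Z(\<xi>) = B Y(\<xi>), \qquad P(\<xi>) = (\<delta>(\<xi>)/\<tau>) E + A; \]
  the zero initial values make it hold in the coefficient \<open>n = 0\<close> as well, where the scheme
  imposes nothing. As \<open>P(0)\<close> is invertible, \<open>P\<close> has an inverse power series, and
  \[ C^T Z(\<xi>) = C^T P(\<xi>)^{-1} B Y(\<xi>) = W(\<xi>) Y(\<xi>), \]
  where the coefficients of \<open>W\<close> are the weights \<open>\<omega>\<^sub>n\<close>. The coefficient of \<open>\<xi>\<^sup>n\<close> of the right-hand
  side is the convolution in the claim, and that of the left-hand side is the right-hand side of
  the first equation of the scheme.

  The weights are defined by the expansion of an analytic function, whereas the elimination of \<open>Z\<close>
  is an identity of formal power series. Cramer's rule connects the two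
  (\<open>has_matrix_fps_expansion_inverse\<close>): it writes the entries of the pointwise inverse
  \<open>P(\<xi>)\<^sup>-\<^sup>1\<close> as quotients of determinants, hence as functions that have a power series
  expansion, and uniqueness of expansions turns the pointwise identity \<open>P(\<xi>)\<^sup>-\<^sup>1 P(\<xi>) = 1\<close> into a
  formal one.
\<close>

(* "$" is to select vector components only, not coefficients of power series. *)
unbundle no Formal_Power_Series.fps_syntax

section \<open>Power series expansions of matrix-valued functions\<close>

definition has_matrix_fps_expansion ::
    "(complex \<Rightarrow> complex^'n^'m) \<Rightarrow> complex fps^'n^'m \<Rightarrow> bool"
    (infixl "has'_matrix'_fps'_expansion" 60) where
  "f has_matrix_fps_expansion G \<longleftrightarrow>
     (\<forall>i j. (\<lambda>\<xi>. f \<xi> $ i $ j) has_fps_expansion G $ i $ j)"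

abbreviation const_matrix :: "real^'n^'m \<Rightarrow> complex fps^'n^'m" where
  "const_matrix \<equiv> map_matrix (\<lambda>c. fps_const (of_real c))"

lemma has_matrix_fps_expansion_unique:
  assumes "f has_matrix_fps_expansion G" and "f has_matrix_fps_expansion H"
  shows "G = H"
  using assms fps_expansion_unique_complex
  unfolding has_matrix_fps_expansion_def vec_eq_iff by blast

lemma has_matrix_fps_expansion_const:
  "(\<lambda>_. map_matrix of_real A) has_matrix_fps_expansion const_matrix A"
  by (simp add: has_matrix_fps_expansion_def)

lemma has_matrix_fps_expansion_mat:
  assumes "f has_fps_expansion F"
  shows "(\<lambda>\<xi>. mat (f \<xi>)) has_matrix_fps_expansion mat F"
  using assms by (auto simp: has_matrix_fps_expansion_def mat_def)

lemma has_matrix_fps_expansion_add: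
  assumes "f has_matrix_fps_expansion F" and "g has_matrix_fps_expansion G"
  shows "(\<lambda>\<xi>. f \<xi> + g \<xi>) has_matrix_fps_expansion F + G"
  using assms by (auto simp: has_matrix_fps_expansion_def intro!: fps_expansion_intros)

lemma has_matrix_fps_expansion_mult:
  assumes "f has_matrix_fps_expansion F" and "g has_matrix_fps_expansion G"
  shows "(\<lambda>\<xi>. f \<xi> ** g \<xi>) has_matrix_fps_expansion F ** G"
  using assms
  by (auto simp: has_matrix_fps_expansion_def matrix_matrix_mult_def intro!: fps_expansion_intros)

lemma has_fps_expansion_det:
  assumes "f has_matrix_fps_expansion F"
  shows "(\<lambda>\<xi>. det (f \<xi>)) has_fps_expansion det F"
proof -
  have "(\<lambda>\<xi>. of_int (sign p)) has_fps_expansion of_int (sign p)" for p :: "'a \<Rightarrow> 'a"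
    by (simp flip: fps_of_int)
  then show ?thesis
    using assms unfolding det_def has_matrix_fps_expansion_def
    by (intro has_fps_expansion_sum has_fps_expansion_mult has_fps_expansion_prod) auto
qed

lemma matrix_inv_inverse:
  assumes "invertible A"
  shows matrix_inv_right: "A ** matrix_inv A = mat 1"
    and matrix_inv_left: "matrix_inv A ** A = mat 1"
  using assms unfolding invertible_def matrix_inv_def by (auto intro: someI2_ex)

lemma matrix_inv_cramer:
  fixes A :: "'a::field^'n^'n"
  assumes "det A \<noteq> 0"
  shows "matrix_inv A $ k $ l = det (\<chi> i j. if j = k then mat 1 $ i $ l else A $ i $ j) / det A"
proof -
  have "A ** matrix_inv A = mat 1"
    using assms by (simp add: invertible_det_nz matrix_inv_right)
  then have "A *v column l (matrix_inv A) = column l (mat 1)"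
    by (simp add: vec_eq_iff matrix_matrix_mult_def matrix_vector_mult_def column_def)
  then have "column l (matrix_inv A)
      = (\<chi> k. det (\<chi> i j. if j = k then column l (mat 1) $ i else A $ i $ j) / det A)"
    using cramer[OF assms] by blast
  then have "column l (matrix_inv A) $ k
      = det (\<chi> i j. if j = k then column l (mat 1) $ i else A $ i $ j) / det A"
    by simp
  then show ?thesis
    by (simp add: column_def cong: if_cong)
qed

text \<open>The determinants in Cramer's rule have expansions, and the one in the denominator does not
  vanish near \<open>0\<close>. So the pointwise inverse has an expansion, and the product with the given
  expansion is the identity because both expand the constant function.\<close>

lemma has_matrix_fps_expansion_inverse:
  fixes f :: "complex \<Rightarrow> complex^'n^'n"
  assumes f: "f has_matrix_fps_expansion G" and inv: "invertible (f 0)"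
  obtains H where "(\<lambda>\<xi>. matrix_inv (f \<xi>)) has_matrix_fps_expansion H" and "H ** G = mat 1"
proof -
  have det: "(\<lambda>\<xi>. det (f \<xi>)) has_fps_expansion det G"
    by (rule has_fps_expansion_det[OF f])
  have nz: "det (f 0) \<noteq> 0"
    using inv by (simp add: invertible_det_nz)
  have nth0: "fps_nth (det G) 0 \<noteq> 0"
    using has_fps_expansion_imp_0_eq_fps_nth_0[OF det] nz by simp
  have "isCont (\<lambda>\<xi>. det (f \<xi>)) 0"
    using has_fps_expansion_imp_continuous[OF det] .
  then have ev: "eventually (\<lambda>\<xi>. det (f \<xi>) \<noteq> 0) (nhds 0)"
    using nz by (simp add: isCont_def tendsto_imp_eventually_ne eventually_nhds_conv_at)
  define H where "H = (\<chi> k l.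
    det (\<chi> i j. if j = k then mat 1 $ i $ l else G $ i $ j) / det G)"
  have H: "(\<lambda>\<xi>. matrix_inv (f \<xi>)) has_matrix_fps_expansion H"
    unfolding has_matrix_fps_expansion_def
  proof (intro allI)
    fix k l
    have "(\<lambda>\<xi>. \<chi> i j. if j = k then mat 1 $ i $ l else f \<xi> $ i $ j) has_matrix_fps_expansion
        (\<chi> i j. if j = k then mat 1 $ i $ l else G $ i $ j)"
      using f by (auto simp: has_matrix_fps_expansion_def mat_def)
    then have "(\<lambda>\<xi>. det (\<chi> i j. if j = k then mat 1 $ i $ l else f \<xi> $ i $ j) / det (f \<xi>))
        has_fps_expansion H $ k $ l"
      unfolding H_def by (simp add: has_fps_expansion_divide' has_fps_expansion_det det nth0)
    moreover have "eventually (\<lambda>\<xi>. matrix_inv (f \<xi>) $ k $ l =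
        det (\<chi> i j. if j = k then mat 1 $ i $ l else f \<xi> $ i $ j) / det (f \<xi>)) (nhds 0)"
      using ev by eventually_elim (rule matrix_inv_cramer)
    ultimately show "(\<lambda>\<xi>. matrix_inv (f \<xi>) $ k $ l) has_fps_expansion H $ k $ l"
      by (rule iffD2[OF has_fps_expansion_cong[OF _ refl], rotated])
  qed
  have "(\<lambda>_. mat 1) has_matrix_fps_expansion H ** G"
    unfolding has_matrix_fps_expansion_def
  proof (intro allI)
    fix i j
    have "(\<lambda>\<xi>. (matrix_inv (f \<xi>) ** f \<xi>) $ i $ j) has_fps_expansion (H ** G) $ i $ j"
      using has_matrix_fps_expansion_mult[OF H f] by (simp add: has_matrix_fps_expansion_def)
    moreover have "eventually (\<lambda>\<xi>. (mat 1 :: complex^'n^'n) $ i $ j =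
        (matrix_inv (f \<xi>) ** f \<xi>) $ i $ j) (nhds 0)"
      using ev by eventually_elim (simp add: invertible_det_nz matrix_inv_left)
    ultimately show "(\<lambda>_. mat 1 $ i $ j) has_fps_expansion (H ** G) $ i $ j"
      by (rule iffD2[OF has_fps_expansion_cong[OF _ refl], rotated])
  qed
  moreover have "(\<lambda>_. mat 1) has_matrix_fps_expansion (mat 1 :: complex fps^'n^'n)"
    by (intro has_matrix_fps_expansion_mat fps_expansion_intros)
  ultimately have "H ** G = mat 1"
    by (rule has_matrix_fps_expansion_unique)
  with H show ?thesis
    by (rule that)
qed

section \<open>Generating functions of vector sequences\<close>

definition genfun :: "(nat \<Rightarrow> real^'n) \<Rightarrow> complex fps^'n" where
  "genfun v = (\<chi> i. Abs_fps (\<lambda>n. of_real (v n $ i)))"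

lemma genfun_eq_iff: "genfun u = genfun v \<longleftrightarrow> u = v"
  by (auto simp: genfun_def vec_eq_iff fps_eq_iff fun_eq_iff)

lemma genfun_add: "genfun (\<lambda>n. u n + v n) = genfun u + genfun v"
  by (simp add: genfun_def vec_eq_iff fps_eq_iff)

lemma genfun_matrix_mult: "genfun (\<lambda>n. A *v v n) = const_matrix A *v genfun v"
  by (simp add: genfun_def vec_eq_iff fps_eq_iff matrix_vector_mult_def fps_sum_nth)

lemma genfun_convolution:
  fixes \<omega> :: "nat \<Rightarrow> real^'n^'m"
  shows "genfun (\<lambda>n. \<Sum>k=0..n. \<omega> (n - k) *v y k) =
    (\<chi> i j. Abs_fps (\<lambda>n. of_real (\<omega> n $ i $ j))) *v genfun y"
proof -
  have "(\<Sum>k=0..n. \<Sum>j\<in>UNIV. \<omega> (n - k) $ i $ j * y k $ j) =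
      (\<Sum>j\<in>UNIV. \<Sum>k=0..n. \<omega> k $ i $ j * y (n - k) $ j)" for n i
    by (subst sum.swap, intro sum.cong refl
      sum.reindex_bij_witness[of _ "\<lambda>k. n - k" "\<lambda>k. n - k"]) auto
  then show ?thesis
    by (simp add: genfun_def vec_eq_iff fps_eq_iff matrix_vector_mult_def fps_sum_nth fps_mult_nth
      flip: of_real_mult of_real_sum)
qed

section \<open>The BDF difference quotient as multiplication by its symbol\<close>

definition bdf_symbol :: "nat \<Rightarrow> real \<Rightarrow> complex fps" where
  "bdf_symbol m \<tau> = (\<Sum>k=0..m. fps_const (of_real (bdf_coeff m k / \<tau>)) * fps_X ^ (m - k))"

lemma bdf_symbol_expansion:
  "(\<lambda>\<xi>. bdf_delta m \<xi> / of_real \<tau>) has_fps_expansion bdf_symbol m \<tau>"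
proof -
  have "(\<lambda>\<xi>. bdf_delta m \<xi> / of_real \<tau> :: complex) =
      (\<lambda>\<xi>. \<Sum>k=0..m. of_real (bdf_coeff m k / \<tau>) * \<xi> ^ (m - k))"
    by (simp add: bdf_delta_def sum_divide_distrib)
  then show ?thesis
    unfolding bdf_symbol_def by (simp only:) (intro fps_expansion_intros)
qed

text \<open>Multiplication by \<open>\<xi>\<^bsup>m-k\<^esup>\<close> shifts a sequence by \<open>m - k\<close> places and fills up with zeros,
  which is the convention for negative indices in the difference quotient.\<close>

lemma genfun_bdf_diff: "genfun (bdf_diff m \<tau> v) = bdf_symbol m \<tau> *s genfun v"
proof -
  have "complex_of_real (bdf_diff m \<tau> v n $ i) = fps_nth (bdf_symbol m \<tau> * genfun v $ i) n" for n i
  proof -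
    have "fps_nth (bdf_symbol m \<tau> * genfun v $ i) n =
      (\<Sum>k=0..m. of_real (bdf_coeff m k / \<tau>) *
        (if n < m - k then 0 else of_real (v (n - (m - k)) $ i)))"
      by (simp add: bdf_symbol_def genfun_def sum_distrib_right fps_sum_nth mult.assoc
        fps_X_power_mult_nth del: of_real_divide cong: if_cong)
    also have "\<dots> = (\<Sum>k=0..m. of_real (1 / \<tau> *
        (bdf_coeff m k * (if n + k < m then 0 else v (n + k - m) $ i))))"
      by (intro sum.cong refl) (auto simp: less_diff_conv)
    also have "\<dots> = of_real (bdf_diff m \<tau> v n $ i)"
      by (simp add: bdf_diff_def sum_distrib_left if_distrib[of "\<lambda>x. x $ i"]
        cong: if_cong)
    finally show ?thesis ..
  qed
  then show ?thesis
    by (simp add: vec_eq_iff fps_eq_iff) (simp add: genfun_def)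
qed

lemma bdf_diff_0:
  assumes "v 0 = 0"
  shows "bdf_diff m \<tau> v 0 = 0"
proof -
  have "(\<Sum>k=0..m. bdf_coeff m k *\<^sub>R (if 0 + k < m then 0 else v (0 + k - m))) = 0"
    using assms by (intro sum.neutral) auto
  then show ?thesis
    by (simp only: bdf_diff_def scaleR_zero_right)
qed

section \<open>Elimination of the second component\<close>

lemma mat_mult_nth: "(mat s ** A) $ i $ j = s * A $ i $ j"
  by (simp add: matrix_matrix_mult_def mat_def if_distrib[of "\<lambda>x. x * c" for c] cong: if_cong)

lemma map_matrix_of_real_mult:
  "map_matrix of_real (A ** B) =
    (map_matrix of_real A ** map_matrix of_real B :: complex^'n^'m)"
  by (simp add: vec_eq_iff matrix_matrix_mult_def)

lemma invertible_map_matrix_of_real: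
  fixes A :: "real^'n^'n"
  assumes "invertible A"
  shows "invertible (map_matrix of_real A :: complex^'n^'n)"
proof -
  obtain A' where "A ** A' = mat 1"
    using assms by (auto simp: invertible_def)
  then have "map_matrix of_real A ** map_matrix of_real A' =
      (map_matrix of_real (mat 1) :: complex^'n^'n)"
    by (simp flip: map_matrix_of_real_mult)
  also have "\<dots> = mat 1"
    by (simp add: vec_eq_iff mat_def)
  finally show ?thesis
    using invertible_right_inverse by blast
qed

theorem lemma3p1:
  fixes m :: nat and \<tau> :: real
    and M :: "real^'p \<Rightarrow> real^'p^'p" and F :: "real^'p \<Rightarrow> real^'p"
    and E A :: "real^'q^'q" and B C :: "real^'p^'q"
    and y :: "nat \<Rightarrow> real^'p" and z :: "nat \<Rightarrow> real^'q"
    and \<omega> :: "nat \<Rightarrow> real^'p^'p"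
  assumes "m \<ge> 1" and "\<tau> > 0"
    and "invertible ((bdf_delta m 0 / \<tau>) *\<^sub>R E + A)"
    and "y 0 = 0" and "z 0 = 0"
    and "\<And>n. n \<ge> 1 \<Longrightarrow> M (y n) *v bdf_diff m \<tau> y n + F (y n) = transpose C *v z n"
    and "\<And>n. n \<ge> 1 \<Longrightarrow> E *v bdf_diff m \<tau> z n + A *v z n = B *v y n"
    and "is_quadrature_weights m \<tau> E A B C \<omega>"
  shows "\<forall>n\<ge>1. M (y n) *v bdf_diff m \<tau> y n + F (y n) = (\<Sum>k=0..n. \<omega> (n - k) *v y k)"
proof -
  define p where "p \<xi> = mat (bdf_delta m \<xi> / of_real \<tau>) ** map_matrix of_real E
    + map_matrix of_real A" for \<xi> :: complex
  define P where "P = mat (bdf_symbol m \<tau>) ** const_matrix E + const_matrix A"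
  define W where "W = (\<chi> i j. Abs_fps (\<lambda>n. complex_of_real (\<omega> n $ i $ j)))"
  have p: "p has_matrix_fps_expansion P"
    unfolding p_def P_def
    by (intro has_matrix_fps_expansion_add has_matrix_fps_expansion_mult
      has_matrix_fps_expansion_mat has_matrix_fps_expansion_const bdf_symbol_expansion)

  have "bdf_delta m (0::complex) = of_real (bdf_delta m 0)"
    by (simp add: bdf_delta_def)
  then have "p 0 = map_matrix of_real ((bdf_delta m 0 / \<tau>) *\<^sub>R E + A)"
    by (simp add: p_def vec_eq_iff mat_mult_nth)
  then have "invertible (p 0)"
    using invertible_map_matrix_of_real[OF assms(3)] by simp
  with p obtain R where R: "(\<lambda>\<xi>. matrix_inv (p \<xi>)) has_matrix_fps_expansion R"
    and RP: "R ** P = mat 1"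
    by (rule has_matrix_fps_expansion_inverse)

  have "(\<lambda>\<xi>. transfer_fun E A B C (bdf_delta m \<xi> / of_real \<tau>)) has_matrix_fps_expansion
      const_matrix (transpose C) ** R ** const_matrix B"
    unfolding transfer_fun_def p_def[symmetric]
    by (intro has_matrix_fps_expansion_mult has_matrix_fps_expansion_const R)
  moreover have "(\<lambda>\<xi>. transfer_fun E A B C (bdf_delta m \<xi> / of_real \<tau>))
      has_matrix_fps_expansion W"
    using assms(8) by (simp add: is_quadrature_weights_def has_matrix_fps_expansion_def W_def)
  ultimately have W: "W = const_matrix (transpose C) ** R ** const_matrix B"
    using has_matrix_fps_expansion_unique by blast

  \<comment> \<open>The scheme starts at \<open>n = 1\<close>, but generating functions need every coefficient; at \<open>n = 0\<close>
    both sides vanish.\<close>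
  have "E *v bdf_diff m \<tau> z n + A *v z n = B *v y n" for n
    using assms(4,5) assms(7)[of n] by (cases n) (simp_all add: bdf_diff_0)
  then have "genfun (\<lambda>n. E *v bdf_diff m \<tau> z n + A *v z n) = genfun (\<lambda>n. B *v y n)"
    by simp
  moreover have "mat s ** Q *v v = Q *v (s *s v)"
    for s :: "complex fps" and Q :: "complex fps^'q^'q" and v
    by (simp add: vec_eq_iff matrix_vector_mult_def mat_mult_nth mult_ac)
  ultimately have "P *v genfun z = const_matrix B *v genfun y"
    by (simp add: P_def genfun_add genfun_matrix_mult genfun_bdf_diff matrix_vector_mult_add_rdistrib)
  then have "(R ** P) *v genfun z = R *v (const_matrix B *v genfun y)"
    by (simp flip: matrix_vector_mul_assoc)
  then have "genfun z = R *v (const_matrix B *v genfun y)"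
    by (simp add: RP)
  then have "const_matrix (transpose C) *v genfun z = W *v genfun y"
    by (simp add: W matrix_vector_mul_assoc matrix_mul_assoc)
  then have "(\<lambda>n. transpose C *v z n) = (\<lambda>n. \<Sum>k=0..n. \<omega> (n - k) *v y k)"
    by (simp only: W_def flip: genfun_eq_iff genfun_matrix_mult genfun_convolution)
  then show ?thesis
    using assms(6) by (simp add: fun_eq_iff)
qed

end
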